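(* Let $k\ge 1$ be an integer and let $G$ be a finite simple graph with $n\ge 2$ vertices and $m$ edges such that $\tau(G)\geq k$. Then $rmc_k(G)\geq m-k(n-2)$.
   Context: An edge-coloring of a graph assigns a color to each edge; adjacent edges may receive the same color. A path is monochromatic if all its edges have the same color. For distinct vertices $u,v$ of an edge-colored graph, $k$ rainbow monochromatic $uv$-paths are $k$ edge-disjoint monochromatic $uv$-paths whose colors are pairwise different. An edge-coloring of $G$ is an $RMC_k$-coloring if every two distinct vertices of $G$ are connected by at least $k$ rainbow monochromatic paths. For a graph $G$ having an $RMC_k$-coloring, $rmc_k(G)$ is the maximum number of colors used in an $RMC_k$-coloring of $G$. For a partition $\mathcal{P}=\{V_1,\dots,V_t\}$ of $V(G)$ into nonempty sets, $G/\mathcal{P}$ is the graph obtained by deleting, for each $i$, all edges with both ends in $V_i$ and merging the vertices of $V_i$ into a single vertex (parallel edges are kept). Here $|G/\mathcal P|=|\mathcal P|$ is the number of vertices and $e(G/\mathcal P)$ the number of edges of $G/\mathcal P$. Define $\tau(G)=\min_{|\mathcal{P}|\geq 2}\frac{e(G/\mathcal{P})}{|G/\mathcal{P}|-1}$, the minimum being over all partitions of $V(G)$ with at least two parts. (A graph with $\tau(G)\ge k$ has an $RMC_k$-coloring, so $rmc_k(G)$ is defined.) *)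

theory Defs
  imports Complex_Main "HOL-Library.Disjoint_Sets"
begin

text \<open>Edges are two-element vertex sets, so there are no loops and no parallel edges.\<close>

definition finite_simple_graph :: "'a set \<Rightarrow> 'a set set \<Rightarrow> bool" where
  "finite_simple_graph V E \<longleftrightarrow> finite V \<and> (\<forall>e\<in>E. e \<subseteq> V \<and> card e = 2)"

text \<open>A path is given by the list of its vertices, in order from \<open>u\<close> to \<open>v\<close>.\<close>

definition path_edges :: "'a list \<Rightarrow> 'a set set" where
  "path_edges p = {{p ! i, p ! Suc i} | i. Suc i < length p}"

definition is_uv_path :: "'a set \<Rightarrow> 'a set set \<Rightarrow> 'a \<Rightarrow> 'a \<Rightarrow> 'a list \<Rightarrow> bool" where
  "is_uv_path V E u v p \<longleftrightarrow>
     p \<noteq> [] \<and> distinct p \<and> set p \<subseteq> V \<and> hd p = u \<and> last p = v \<and> path_edges p \<subseteq> E"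

text \<open>
  An edge-coloring is a function \<open>c\<close> of which only the values on \<open>E\<close> matter. The palette is
  \<open>nat\<close>; this is no restriction, since a finite graph uses only finitely many colors.
\<close>

definition path_colors :: "('a set \<Rightarrow> nat) \<Rightarrow> 'a list \<Rightarrow> nat set" where
  "path_colors c p = c ` path_edges p"

definition monochromatic :: "('a set \<Rightarrow> nat) \<Rightarrow> 'a list \<Rightarrow> bool" where
  "monochromatic c p \<longleftrightarrow> (\<exists>a. path_colors c p = {a})"

text \<open>
  The color of a monochromatic path is represented by the singleton \<open>path_colors c p\<close>, so
  injectivity of \<open>path_colors c\<close> on \<open>Q\<close> says that the colors of the paths in \<open>Q\<close> are pairwise
  different.
\<close>

definition rainbow_monochromatic_paths ::
  "'a set \<Rightarrow> 'a set set \<Rightarrow> ('a set \<Rightarrow> nat) \<Rightarrow> 'a \<Rightarrow> 'a \<Rightarrow> 'a list set \<Rightarrow> bool" where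
  "rainbow_monochromatic_paths V E c u v Q \<longleftrightarrow>
     (\<forall>p\<in>Q. is_uv_path V E u v p \<and> monochromatic c p) \<and>
     disjoint_family_on path_edges Q \<and>
     inj_on (path_colors c) Q"

definition RMC_coloring :: "nat \<Rightarrow> 'a set \<Rightarrow> 'a set set \<Rightarrow> ('a set \<Rightarrow> nat) \<Rightarrow> bool" where
  "RMC_coloring k V E c \<longleftrightarrow>
     (\<forall>u\<in>V. \<forall>v\<in>V. u \<noteq> v \<longrightarrow>
        (\<exists>Q. finite Q \<and> card Q \<ge> k \<and> rainbow_monochromatic_paths V E c u v Q))"

text \<open>Unspecified if the graph has no \<open>RMC_coloring\<close> for \<open>k\<close>.\<close>

definition rmc :: "nat \<Rightarrow> 'a set \<Rightarrow> 'a set set \<Rightarrow> nat" where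
  "rmc k V E = Max {card (c ` E) | c. RMC_coloring k V E c}"

text \<open>
  The quotient by a partition \<open>P\<close> has vertex set \<open>P\<close>. Its edges are the edges of the graph
  not contained in a part, kept as edges of the original graph so that edges which become
  parallel are still counted separately.
\<close>

definition quotient_edges :: "'a set set \<Rightarrow> 'a set set \<Rightarrow> 'a set set" where
  "quotient_edges E P = {e \<in> E. \<not> (\<exists>A\<in>P. e \<subseteq> A)}"

definition tau :: "'a set \<Rightarrow> 'a set set \<Rightarrow> real" where
  "tau V E = Min {real (card (quotient_edges E P)) / (real (card P) - 1) | P.
     partition_on V P \<and> card P \<ge> 2}"

end

theory Submission
  imports Defs
begin

text \<open>
  The coloring gives each of \<open>k\<close> edge-disjoint spanning trees a color of its own and every other
  edge a private color. Two vertices are then joined by one monochromatic path in each tree, and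
  the number of colors is \<open>m - k (n - 1) + k\<close>. What has to be proved is therefore the
  tree-packing theorem of Nash-Williams and Tutte: \<open>\<tau>(G) \<ge> k\<close> yields the \<open>k\<close> trees.

  The trees come from the matroid union theorem. Among all families of \<open>k\<close> disjoint forests, take
  one that covers as many edges as possible, and let \<open>R\<close> be the set of all edges that are left
  uncovered by some family obtained from it by successive exchanges (an uncovered edge enters a
  forest and an edge of the cycle so closed leaves it). Every exchange stays within \<open>R\<close>, so it does
  not change what the \<open>R\<close>-part of a forest spans. Since an uncovered edge is always spanned by the
  \<open>R\<close>-part of each forest, the \<open>R\<close>-part of each original forest spans all of \<open>R\<close>
  (\<open>ex_packing_spanning_core\<close>).

  Now let \<open>c\<close> be the number of components of \<open>(V, R)\<close>. Each forest has \<open>n - c\<close> edges in \<open>R\<close>, and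
  all edges outside \<open>R\<close> are covered. The edges between different components are among
  these, so there are at least \<open>k (c - 1)\<close> of them by the hypothesis on \<open>\<tau>\<close>. Thus the forests
  have at least \<open>k (n - c) + k (c - 1) = k (n - 1)\<close> edges in total, which forces each of them to be
  a spanning tree (\<open>tree_packing\<close>).
\<close>

section \<open>Packing independent sets of a matroid\<close>

text \<open>
  A matroid is given by its closure operator. For the cycle matroid of a graph
  this is the most convenient presentation, because \<open>e \<in> cl A\<close> just says that the ends
  of \<open>e\<close> are connected in \<open>A\<close>.
\<close>

locale exchange_closure =
  fixes cl :: "'e set \<Rightarrow> 'e set"
  assumes cl_extensive: "A \<subseteq> cl A"
    and cl_mono: "A \<subseteq> B \<Longrightarrow> cl A \<subseteq> cl B"
    and cl_idem: "cl (cl A) = cl A"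
    and cl_exchange: "\<lbrakk>f \<in> cl (insert e A); f \<notin> cl A\<rbrakk> \<Longrightarrow> e \<in> cl (insert f A)"
begin

definition indep :: "'e set \<Rightarrow> bool" where
  "indep A \<longleftrightarrow> (\<forall>a\<in>A. a \<notin> cl (A - {a}))"

lemma cl_least: "A \<subseteq> cl B \<Longrightarrow> cl A \<subseteq> cl B"
  using cl_mono[of A "cl B"] cl_idem by simp

lemma indep_subset: "\<lbrakk>indep A; B \<subseteq> A\<rbrakk> \<Longrightarrow> indep B"
  unfolding indep_def using cl_mono by (meson Diff_mono in_mono order_refl)

lemma indep_insert:
  assumes "indep A" "e \<notin> cl A"
  shows "indep (insert e A)"
  unfolding indep_def
proof
  fix a assume a: "a \<in> insert e A"
  have "e \<notin> A" using assms(2) cl_extensive by blast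
  show "a \<notin> cl (insert e A - {a})"
  proof (cases "a = e")
    case True
    then show ?thesis using assms(2) \<open>e \<notin> A\<close> by simp
  next
    case False
    then have "a \<in> A" using a by simp
    then have "insert e A - {a} = insert e (A - {a})" "insert a (A - {a}) = A"
      using False by auto
    then show ?thesis
      using cl_exchange[of a e "A - {a}"] assms \<open>a \<in> A\<close> unfolding indep_def by auto
  qed
qed

text \<open>
  The set \<open>{f \<in> A. e \<notin> cl (A - {f})}\<close> is the fundamental circuit of \<open>e\<close> in \<open>A\<close> without \<open>e\<close>: these
  are the elements that may be traded for \<open>e\<close>. A minimal subset of \<open>A\<close> that spans \<open>e\<close> consists of
  such elements only.
\<close>

lemma in_cl_fundamental_circuit:
  assumes "finite A" "indep A" "e \<in> cl A"
  shows "e \<in> cl {f \<in> A. e \<notin> cl (A - {f})}"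
proof -
  obtain C where C: "C \<subseteq> A" "e \<in> cl C"
    and min: "\<And>D. D \<subseteq> A \<Longrightarrow> e \<in> cl D \<Longrightarrow> card C \<le> card D"
    using ex_has_least_nat[of "\<lambda>C. C \<subseteq> A \<and> e \<in> cl C" A card] assms(3) by blast
  have "e \<notin> cl (A - {f})" if f: "f \<in> C" for f
  proof
    assume e: "e \<in> cl (A - {f})"
    have "card (C - {f}) < card C"
      using f C(1) assms(1) by (meson card_Diff1_less finite_subset)
    then have "e \<notin> cl (C - {f})" using min[of "C - {f}"] C(1) by force
    moreover have "e \<in> cl (insert f (C - {f}))" using C(2) f by (simp add: insert_absorb)
    ultimately have "f \<in> cl (insert e (C - {f}))" by (rule cl_exchange[rotated])
    moreover have "insert e (C - {f}) \<subseteq> cl (A - {f})"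
      using e C(1) cl_extensive[of "A - {f}"] by blast
    ultimately have "f \<in> cl (A - {f})" using cl_least by blast
    then show False using assms(2) C(1) f unfolding indep_def by blast
  qed
  then have "C \<subseteq> {f \<in> A. e \<notin> cl (A - {f})}" using C(1) by blast
  then show ?thesis using cl_mono C(2) by blast
qed

definition packing :: "nat \<Rightarrow> 'e set \<Rightarrow> (nat \<Rightarrow> 'e set) \<Rightarrow> bool" where
  "packing k E F \<longleftrightarrow>
     (\<forall>i<k. F i \<subseteq> E \<and> indep (F i)) \<and> disjoint_family_on F {..<k}"

definition uncovered :: "nat \<Rightarrow> 'e set \<Rightarrow> (nat \<Rightarrow> 'e set) \<Rightarrow> 'e set" where
  "uncovered k E F = E - (\<Union>i<k. F i)"

inductive exchanges :: "nat \<Rightarrow> 'e set \<Rightarrow> (nat \<Rightarrow> 'e set) \<Rightarrow> (nat \<Rightarrow> 'e set) \<Rightarrow> bool"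
  for k E F where
  refl: "exchanges k E F F"
| step: "\<lbrakk>exchanges k E F G; i < k; e \<in> uncovered k E G; f \<in> G i; e \<notin> cl (G i - {f})\<rbrakk>
    \<Longrightarrow> exchanges k E F (G(i := insert e (G i - {f})))"

lemma packing_update:
  assumes "packing k E F" "i < k" "X \<subseteq> insert e (F i)" "e \<in> uncovered k E F" "indep X"
  shows "packing k E (F(i := X))"
proof -
  have dj: "F p \<inter> F q = {}" if "p < k" "q < k" "p \<noteq> q" for p q
    using assms(1) that unfolding packing_def disjoint_family_on_def by simp
  have ex: "e \<notin> F j" if "j < k" for j
    using assms(4) that unfolding uncovered_def by blast
  have X: "X \<inter> F j = {}" if "j < k" "j \<noteq> i" for j
    using assms(3) dj[OF assms(2) that(1)] ex[OF that(1)] that(2) by blast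
  have "e \<in> E" "F i \<subseteq> E" using assms(1,2,4) unfolding packing_def uncovered_def by auto
  then have "X \<subseteq> E" using assms(3) by blast
  then have "\<forall>j<k. (F(i := X)) j \<subseteq> E \<and> indep ((F(i := X)) j)"
    using assms(1,5) unfolding packing_def by simp
  moreover have "(F(i := X)) p \<inter> (F(i := X)) q = {}" if "p < k" "q < k" "p \<noteq> q" for p q
    using that dj[of p q] X[of p] X[of q] by (cases "p = i"; cases "q = i") auto
  ultimately show ?thesis unfolding packing_def disjoint_family_on_def by simp
qed

lemma packing_exchange:
  assumes F: "packing k E F" and i: "i < k" and e: "e \<in> uncovered k E F"
    and f: "f \<in> F i" and ef: "e \<notin> cl (F i - {f})"
  shows "packing k E (F(i := insert e (F i - {f})))"
    and "uncovered k E (F(i := insert e (F i - {f}))) = insert f (uncovered k E F - {e})"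
proof -
  have "indep (F i)" using F i unfolding packing_def by blast
  then have "indep (insert e (F i - {f}))"
    using indep_insert[OF indep_subset ef] by blast
  then show "packing k E (F(i := insert e (F i - {f})))"
    by (intro packing_update[OF F i _ e]) auto
  have *: "f \<notin> F j" if "j < k" "j \<noteq> i" for j
    using F i f that unfolding packing_def disjoint_family_on_def by blast
  have "f \<in> E" "f \<noteq> e" using F i f e unfolding packing_def uncovered_def by auto
  then show "uncovered k E (F(i := insert e (F i - {f}))) = insert f (uncovered k E F - {e})"
    using * i e unfolding uncovered_def by (auto split: if_splits)
qed

lemma exchanges_packing:
  assumes "exchanges k E F G" "packing k E F" "finite E"
  shows "packing k E G \<and> card (uncovered k E G) = card (uncovered k E F)"
  using assms(1)
proof (induction rule: exchanges.induct)
  case refl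
  then show ?case using assms by simp
next
  case (step G i e f)
  have "finite (uncovered k E G)" using assms(3) unfolding uncovered_def by simp
  moreover have "f \<notin> uncovered k E G" using step.hyps unfolding uncovered_def by blast
  ultimately have "card (insert f (uncovered k E G - {e})) = card (uncovered k E G)"
    using card_Suc_Diff1[of "uncovered k E G" e] step.hyps(3) by simp
  moreover have "packing k E G" "card (uncovered k E G) = card (uncovered k E F)"
    using step.IH by auto
  ultimately show ?case
    using packing_exchange[OF _ step.hyps(2-5)] by (simp del: fun_upd_apply)
qed

text \<open>
  This is the nontrivial direction of the matroid union theorem for \<open>k\<close> copies of one matroid. The
  set \<open>R\<close> certifies that no packing covers more: outside \<open>R\<close> everything is covered, and inside
  \<open>R\<close> each of the \<open>k\<close> sets is as large as an independent set can be.
\<close>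

theorem ex_packing_spanning_core:
  assumes fin: "finite E"
  obtains F R where "packing k E F" "R \<subseteq> E" "E - R \<subseteq> (\<Union>i<k. F i)"
    "\<And>i. i < k \<Longrightarrow> R \<subseteq> cl (F i \<inter> R)"
proof -
  have "packing k E (\<lambda>_. {})"
    unfolding packing_def indep_def disjoint_family_on_def by simp
  then obtain F where F: "packing k E F"
    and opt: "\<And>G. packing k E G \<Longrightarrow> card (uncovered k E F) \<le> card (uncovered k E G)"
    using ex_has_least_nat[of "packing k E" "\<lambda>_. {}" "\<lambda>G. card (uncovered k E G)"] by blast
  define R where "R = (\<Union>G\<in>{G. exchanges k E F G}. uncovered k E G)"
  \<comment> \<open>By optimality, an uncovered element closes a circuit with each set of the packing, and
    every element of that circuit can be exchanged out, so the circuit lies in \<open>R\<close>.\<close>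
  have spanned: "e \<in> cl (G i \<inter> R)"
    if G: "exchanges k E F G" and i: "i < k" and e: "e \<in> uncovered k E G" for G i e
  proof -
    have pG: "packing k E G" and cG: "card (uncovered k E G) = card (uncovered k E F)"
      using exchanges_packing[OF G F fin] by auto
    have ind: "indep (G i)" and finG: "finite (G i)"
      using pG i fin finite_subset unfolding packing_def by auto
    have "e \<in> cl (G i)"
    proof (rule ccontr)
      assume "e \<notin> cl (G i)"
      then have "packing k E (G(i := insert e (G i)))"
        using packing_update[OF pG i _ e] indep_insert[OF ind] by blast
      then have "card (uncovered k E G) \<le> card (uncovered k E (G(i := insert e (G i))))"
        using opt cG by simp
      moreover have "uncovered k E (G(i := insert e (G i))) = uncovered k E G - {e}"
        using i unfolding uncovered_def by (auto split: if_splits)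
      moreover have "card (uncovered k E G - {e}) < card (uncovered k E G)"
        using e fin unfolding uncovered_def by (intro card_Diff1_less) auto
      ultimately show False by simp
    qed
    then have "e \<in> cl {f \<in> G i. e \<notin> cl (G i - {f})}"
      using in_cl_fundamental_circuit[OF finG ind] by blast
    moreover have "f \<in> R" if f: "f \<in> G i" "e \<notin> cl (G i - {f})" for f
    proof -
      have "f \<in> uncovered k E (G(i := insert e (G i - {f})))"
        using packing_exchange(2)[OF pG i e f] by simp
      then show ?thesis unfolding R_def using exchanges.step[OF G i e f] by blast
    qed
    ultimately show ?thesis using cl_mono[of "{f \<in> G i. e \<notin> cl (G i - {f})}" "G i \<inter> R"] by blast
  qed
  \<comment> \<open>The element that an exchange inserts is already spanned by the \<open>R\<close>-part, so closures of
    \<open>R\<close>-parts cannot grow along a chain of exchanges.\<close>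
  have span_decreasing: "cl (G i \<inter> R) \<subseteq> cl (F i \<inter> R)" if "exchanges k E F G" "i < k" for G i
    using that(1)
  proof (induction rule: exchanges.induct)
    case refl
    then show ?case by simp
  next
    case (step G j e f)
    have "insert e (G i \<inter> R) \<subseteq> cl (G i \<inter> R)"
      using spanned[OF step.hyps(1) that(2) step.hyps(3)] cl_extensive by blast
    then have "cl ((G(j := insert e (G j - {f}))) i \<inter> R) \<subseteq> cl (G i \<inter> R)"
      by (intro cl_least) (auto split: if_splits)
    then show ?case using step.IH by blast
  qed
  show thesis
  proof
    show "packing k E F" by (rule F)
    show "R \<subseteq> E" unfolding R_def uncovered_def by blast
    have "uncovered k E F \<subseteq> R" unfolding R_def using exchanges.refl by blast
    then show "E - R \<subseteq> (\<Union>i<k. F i)" unfolding uncovered_def by blast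
    show "R \<subseteq> cl (F i \<inter> R)" if i: "i < k" for i
    proof
      fix e assume "e \<in> R"
      then obtain G where "exchanges k E F G" "e \<in> uncovered k E G" unfolding R_def by blast
      then show "e \<in> cl (F i \<inter> R)" using spanned span_decreasing i by blast
    qed
  qed
qed

end

section \<open>The cycle matroid\<close>

definition conn :: "'a set set \<Rightarrow> 'a \<Rightarrow> 'a \<Rightarrow> bool" where
  "conn A = (\<lambda>x y. {x, y} \<in> A)\<^sup>*\<^sup>*"

lemma conn_refl [simp]: "conn A x x"
  unfolding conn_def by simp

lemma conn_edge: "{x, y} \<in> A \<Longrightarrow> conn A x y"
  unfolding conn_def by (rule r_into_rtranclp)

lemma conn_trans: "conn A x y \<Longrightarrow> conn A y z \<Longrightarrow> conn A x z"
  unfolding conn_def by (rule rtranclp_trans)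

lemma conn_sym: "conn A x y \<Longrightarrow> conn A y x"
  unfolding conn_def
  by (rule sympD[OF symp_rtranclp]) (simp_all add: symp_def insert_commute)

lemma conn_least:
  assumes "\<And>x y. {x, y} \<in> A \<Longrightarrow> conn B x y" "conn A x y"
  shows "conn B x y"
  using assms(2)[unfolded conn_def]
proof (induction rule: rtranclp_induct)
  case (step y z)
  then show ?case using conn_trans[OF _ assms(1)] by simp
qed simp

lemma conn_mono: "A \<subseteq> B \<Longrightarrow> conn A x y \<Longrightarrow> conn B x y"
  by (rule conn_least[of A]) (simp_all add: conn_edge subset_iff)

lemma conn_insert:
  "conn (insert {a, b} A) x y \<longleftrightarrow>
     conn A x y \<or> conn A x a \<and> conn A b y \<or> conn A x b \<and> conn A a y"
    (is "?L \<longleftrightarrow> ?R y")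
proof
  assume ?L
  then have "(\<lambda>x y. {x, y} \<in> insert {a, b} A)\<^sup>*\<^sup>* x y" unfolding conn_def .
  then show "?R y"
  proof (induction rule: rtranclp_induct)
    case base
    then show ?case by simp
  next
    case (step y z)
    show ?case
    proof (cases "{y, z} \<in> A")
      case True
      then show ?thesis using step.IH conn_edge conn_trans by metis
    next
      case False
      then have "y = a \<and> z = b \<or> y = b \<and> z = a"
        using step.hyps(2) by (auto simp: doubleton_eq_iff)
      then show ?thesis using step.IH by (metis conn_refl conn_trans)
    qed
  qed
next
  have m: "conn A p q \<Longrightarrow> conn (insert {a, b} A) p q" for p q
    by (rule conn_mono[of A]) auto
  have "conn (insert {a, b} A) a b" by (simp add: conn_edge)
  then show "?R y \<Longrightarrow> ?L" using m conn_trans conn_sym by metis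
qed

text \<open>
  The closure contains \<open>A\<close> explicitly so that the closure axioms hold for arbitrary
  families of sets, and not only for families of edges.
\<close>

definition edge_cl :: "'a set set \<Rightarrow> 'a set set" where
  "edge_cl A = A \<union> {{x, y} | x y. conn A x y}"

lemma doubleton_in_edge_cl: "{x, y} \<in> edge_cl A \<longleftrightarrow> conn A x y"
proof
  assume "{x, y} \<in> edge_cl A"
  then consider "{x, y} \<in> A" | p q where "{x, y} = {p, q}" "conn A p q"
    unfolding edge_cl_def by blast
  then show "conn A x y"
    by cases (metis conn_edge, metis conn_sym doubleton_eq_iff)
qed (auto simp: edge_cl_def)

lemma conn_edge_cl: "conn (edge_cl A) x y \<longleftrightarrow> conn A x y"
proof
  show "conn (edge_cl A) x y \<Longrightarrow> conn A x y"
    by (rule conn_least[of "edge_cl A"]) (simp_all add: doubleton_in_edge_cl)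
  show "conn A x y \<Longrightarrow> conn (edge_cl A) x y"
    by (rule conn_mono[of A]) (simp_all add: edge_cl_def)
qed

interpretation cycle_matroid: exchange_closure edge_cl
proof
  fix A B :: "'a set set" and e f :: "'a set"
  show "A \<subseteq> edge_cl A" unfolding edge_cl_def by blast
  show "edge_cl A \<subseteq> edge_cl B" if "A \<subseteq> B"
    using that conn_mono[OF that] unfolding edge_cl_def by blast
  show "edge_cl (edge_cl A) = edge_cl A"
    unfolding edge_cl_def[of "edge_cl A"] conn_edge_cl by (auto simp: edge_cl_def)
  show "e \<in> edge_cl (insert f A)" if f: "f \<in> edge_cl (insert e A)" "f \<notin> edge_cl A"
  proof (cases "f = e")
    case True
    then show ?thesis unfolding edge_cl_def by blast
  next
    case False
    then obtain x y where xy: "f = {x, y}" "conn (insert e A) x y"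
      using f unfolding edge_cl_def by blast
    have n: "\<not> conn A x y" using f(2) unfolding xy(1) doubleton_in_edge_cl .
    obtain a b where e: "e = {a, b}"
    proof (rule ccontr)
      assume "\<not> thesis"
      then have "{p, q} \<in> insert e A \<Longrightarrow> conn A p q" for p q
        using that by (auto intro: conn_edge)
      then show False using n conn_least[OF _ xy(2)] by blast
    qed
    have "conn A x a \<and> conn A b y \<or> conn A x b \<and> conn A a y"
      using xy(2) n unfolding e conn_insert by blast
    then have "conn (insert {x, y} A) a b"
      unfolding conn_insert by (blast intro: conn_sym)
    then show ?thesis unfolding xy(1) e doubleton_in_edge_cl .
  qed
qed

abbreviation forest :: "'a set set \<Rightarrow> bool" where
  "forest \<equiv> cycle_matroid.indep"

definition component :: "'a set \<Rightarrow> 'a set set \<Rightarrow> 'a \<Rightarrow> 'a set" where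
  "component V A x = {y \<in> V. conn A x y}"

definition components :: "'a set \<Rightarrow> 'a set set \<Rightarrow> 'a set set" where
  "components V A = component V A ` V"

lemma component_eq_iff:
  assumes "y \<in> V"
  shows "component V A x = component V A y \<longleftrightarrow> conn A x y"
proof
  have "y \<in> component V A y" using assms unfolding component_def by simp
  then show "component V A x = component V A y \<Longrightarrow> conn A x y"
    unfolding component_def by blast
  show "component V A x = component V A y" if xy: "conn A x y"
  proof -
    have "conn A x z \<longleftrightarrow> conn A y z" for z
      using conn_trans[OF xy] conn_trans[OF conn_sym[OF xy]] by blast
    then show ?thesis unfolding component_def by simp
  qed
qed

lemma partition_on_components: "partition_on V (components V A)"
proof (rule partition_onI)
  show "\<Union>(components V A) = V" unfolding components_def component_def by auto
  show "{} \<notin> components V A" unfolding components_def component_def by auto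
  show "disjnt X Y" if "X \<in> components V A" "Y \<in> components V A" "X \<noteq> Y" for X Y
  proof -
    obtain x y where xy: "X = component V A x" "Y = component V A y" "y \<in> V"
      using \<open>X \<in> _\<close> \<open>Y \<in> _\<close> unfolding components_def by blast
    then have "\<not> conn A x y" using \<open>X \<noteq> Y\<close> component_eq_iff[OF xy(3)] by blast
    then have "\<not> (conn A x z \<and> conn A y z)" for z
      using conn_trans[of A x z y] conn_sym[of A y z] by blast
    then show ?thesis unfolding xy component_def disjnt_def by blast
  qed
qed

lemma components_cong:
  assumes "\<And>x y. conn A x y \<longleftrightarrow> conn B x y"
  shows "components V A = components V B"
  unfolding components_def component_def using assms by simp

lemma components_empty: "components V {} = (\<lambda>x. {x}) ` V"
proof -
  have "conn {} x y \<longleftrightarrow> x = y" for x y :: 'a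
    unfolding conn_def by (subst rtranclp.simps) auto
  then show ?thesis unfolding components_def component_def by auto
qed

text \<open>An edge between two components merges exactly these two.\<close>

lemma card_components_insert:
  assumes "finite V" "a \<in> V" "b \<in> V" "\<not> conn A a b"
  shows "card (components V A) = Suc (card (components V (insert {a, b} A)))"
proof -
  let ?C = "component V A"
  let ?rest = "components V A - {?C a, ?C b}"
  have ab: "?C a \<noteq> ?C b" using assms(4) component_eq_iff[OF assms(3)] by simp
  have merged: "component V (insert {a, b} A) x =
      (if conn A x a \<or> conn A x b then ?C a \<union> ?C b else ?C x)" for x
  proof (cases "conn A x a \<or> conn A x b")
    case True
    have "conn (insert {a, b} A) x y \<longleftrightarrow> conn A a y \<or> conn A b y" for y
      unfolding conn_insert using True conn_trans[of A] conn_sym[of A] by blast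
    then show ?thesis using True unfolding component_def by auto
  next
    case False
    then show ?thesis unfolding component_def conn_insert by auto
  qed
  have "components V (insert {a, b} A) = insert (?C a \<union> ?C b) ?rest"
  proof (intro subset_antisym subsetI)
    fix X assume "X \<in> components V (insert {a, b} A)"
    then obtain x where "x \<in> V" "X = component V (insert {a, b} A) x"
      unfolding components_def by blast
    then show "X \<in> insert (?C a \<union> ?C b) ?rest"
      unfolding merged components_def
      by (simp add: component_eq_iff[OF assms(2)] component_eq_iff[OF assms(3)])
  next
    fix X assume "X \<in> insert (?C a \<union> ?C b) ?rest"
    then consider "X = ?C a \<union> ?C b" | x where "x \<in> V" "X = ?C x" "?C x \<noteq> ?C a" "?C x \<noteq> ?C b"
      unfolding components_def by blast
    then show "X \<in> components V (insert {a, b} A)"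
    proof cases
      case 1
      then have "X = component V (insert {a, b} A) a" unfolding merged by simp
      then show ?thesis using assms(2) unfolding components_def by blast
    next
      case 2
      then have "X = component V (insert {a, b} A) x"
        unfolding merged component_eq_iff[OF assms(2)] component_eq_iff[OF assms(3)] by simp
      then show ?thesis using 2(1) unfolding components_def by blast
    qed
  qed
  moreover have "?C a \<union> ?C b \<notin> ?rest"
  proof
    assume "?C a \<union> ?C b \<in> ?rest"
    then obtain x where x: "?C a \<union> ?C b = ?C x" "?C x \<noteq> ?C a"
      unfolding components_def by auto
    have "a \<in> ?C a" using assms(2) unfolding component_def by simp
    then have "a \<in> ?C x" using x(1) by blast
    then have "conn A x a" unfolding component_def by simp
    then show False using x(2) component_eq_iff[OF assms(2)] by metis
  qed
  moreover have fin: "finite (components V A)" using assms(1) unfolding components_def by simp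
  moreover have "?C a \<in> components V A" "?C b \<in> components V A"
    using assms unfolding components_def by auto
  moreover from this have "card {?C a, ?C b} \<le> card (components V A)"
    by (intro card_mono[OF fin]) simp
  ultimately show ?thesis using ab by (simp add: card_Diff_subset)
qed

lemma card_components_forest:
  assumes "finite V" "finite A" "forest A" "\<And>e. e \<in> A \<Longrightarrow> e \<subseteq> V \<and> card e = 2"
  shows "card (components V A) + card A = card V"
  using assms(2-4)
proof (induction A rule: finite_induct)
  case empty
  show ?case by (simp add: components_empty card_image)
next
  case (insert e A)
  obtain a b where e: "e = {a, b}" using insert.prems(2)[of e] by (auto simp: card_2_iff)
  have "e \<notin> edge_cl A"
    using insert.prems(1) insert.hyps(2) unfolding cycle_matroid.indep_def by auto
  then have "\<not> conn A a b" unfolding e doubleton_in_edge_cl .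
  moreover have "a \<in> V" "b \<in> V" using insert.prems(2)[of e] e by auto
  ultimately have "card (components V A) = Suc (card (components V (insert e A)))"
    unfolding e using card_components_insert assms(1) by metis
  moreover have "forest A" using cycle_matroid.indep_subset insert.prems(1) by blast
  ultimately show ?case using insert by auto
qed

section \<open>Packing spanning trees\<close>

lemma tau_bound:
  assumes "finite V" "tau V E \<ge> real k" "partition_on V P" "card P \<ge> 2"
  shows "k * (card P - 1) \<le> card (quotient_edges E P)"
proof -
  let ?S = "{real (card (quotient_edges E P)) / (real (card P) - 1) | P.
     partition_on V P \<and> card P \<ge> 2}"
  have "{P. partition_on V P} \<subseteq> Pow (Pow V)" unfolding partition_on_def by blast
  then have "finite {P. partition_on V P \<and> card P \<ge> 2}"
    using assms(1) by (auto intro: finite_subset[of _ "Pow (Pow V)"])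
  then have "finite ?S" by (simp add: setcompr_eq_image)
  then have "tau V E \<le> real (card (quotient_edges E P)) / (real (card P) - 1)"
    unfolding tau_def using assms(3,4) by (intro Min_le) auto
  then have "real k \<le> real (card (quotient_edges E P)) / (real (card P) - 1)"
    using assms(2) by simp
  then have "real k * (real (card P) - 1) \<le> real (card (quotient_edges E P))"
    using assms(4) by (simp add: pos_le_divide_eq)
  then have "real (k * (card P - 1)) \<le> real (card (quotient_edges E P))"
    using assms(4) by (simp add: of_nat_diff)
  then show ?thesis by (simp only: of_nat_le_iff)
qed

theorem tree_packing:
  assumes G: "finite_simple_graph V E" and "V \<noteq> {}" and tau: "tau V E \<ge> real k"
  obtains F where "\<And>i. i < k \<Longrightarrow> F i \<subseteq> E" "disjoint_family_on F {..<k}"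
    "\<And>i. i < k \<Longrightarrow> card (F i) = card V - 1"
    "\<And>i x y. \<lbrakk>i < k; x \<in> V; y \<in> V\<rbrakk> \<Longrightarrow> conn (F i) x y"
proof -
  have finV: "finite V" and E: "\<And>e. e \<in> E \<Longrightarrow> e \<subseteq> V \<and> card e = 2"
    using G unfolding finite_simple_graph_def by auto
  then have finE: "finite E" by (intro finite_subset[of E "Pow V"]) auto
  obtain F R where F: "cycle_matroid.packing k E F"
    and cov: "E - R \<subseteq> (\<Union>i<k. F i)" and span: "\<And>i. i < k \<Longrightarrow> R \<subseteq> edge_cl (F i \<inter> R)"
    using cycle_matroid.ex_packing_spanning_core[OF finE] by metis
  have FE: "\<And>i. i < k \<Longrightarrow> F i \<subseteq> E" and forest: "\<And>i. i < k \<Longrightarrow> forest (F i)"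
    and disj: "disjoint_family_on F {..<k}"
    using F unfolding cycle_matroid.packing_def by auto
  have finF: "finite (F i)" if "i < k" for i using FE that finE finite_subset by blast
  have pos: "card (components V A) \<ge> 1" for A
    using finV \<open>V \<noteq> {}\<close> unfolding components_def by (simp add: Suc_le_eq card_gt_0_iff)
  have count: "card (components V A) + card A = card V" if "i < k" "A \<subseteq> F i" for i A
  proof (rule card_components_forest[OF finV])
    show "finite A" using that finF finite_subset by blast
    show "forest A" using that forest cycle_matroid.indep_subset by blast
    show "\<And>e. e \<in> A \<Longrightarrow> e \<subseteq> V \<and> card e = 2" using that FE E by blast
  qed
  define c where "c = card (components V R)"
  \<comment> \<open>The \<open>R\<close>-part of each forest has the same components as \<open>R\<close>.\<close>
  have inside: "card (F i \<inter> R) = card V - c" if i: "i < k" for i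
  proof -
    have "conn R x y \<longleftrightarrow> conn (F i \<inter> R) x y" for x y
    proof
      show "conn R x y \<Longrightarrow> conn (F i \<inter> R) x y"
        using conn_mono[OF span[OF i]] unfolding conn_edge_cl .
      show "conn (F i \<inter> R) x y \<Longrightarrow> conn R x y" by (rule conn_mono[of "F i \<inter> R"]) auto
    qed
    then have "components V R = components V (F i \<inter> R)" by (rule components_cong)
    then show ?thesis using count[OF i, of "F i \<inter> R"] unfolding c_def by simp
  qed
  have "quotient_edges E (components V R) \<subseteq> E - R"
  proof
    fix e assume e: "e \<in> quotient_edges E (components V R)"
    then have "e \<in> E" unfolding quotient_edges_def by simp
    then obtain x y where xy: "e = {x, y}" "x \<in> V" "y \<in> V"
      using E[of e] by (auto simp: card_2_iff)
    have "e \<subseteq> component V R x" if "e \<in> R"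
      using that xy conn_edge[of x y R] unfolding component_def by simp
    then have "e \<notin> R" using e xy(2) unfolding quotient_edges_def components_def by blast
    then show "e \<in> E - R" using \<open>e \<in> E\<close> by blast
  qed
  then have "card (quotient_edges E (components V R)) \<le> card (E - R)"
    using finE by (intro card_mono) auto
  \<comment> \<open>The bound from \<open>\<tau>\<close> needs two parts; if \<open>(V, R)\<close> is connected, the claim is trivial.\<close>
  then have outside: "k * (c - 1) \<le> card (E - R)"
    using tau_bound[OF finV tau partition_on_components, of R] unfolding c_def
    by (cases "card (components V R) \<ge> 2") auto
  have "card (E - R) = card (\<Union>i<k. F i - R)"
  proof (rule arg_cong[where f = card])
    show "E - R = (\<Union>i<k. F i - R)" using cov FE by fastforce
  qed
  also have "\<dots> = (\<Sum>i<k. card (F i - R))"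
  proof (rule card_UN_disjoint)
    show "\<forall>i\<in>{..<k}. \<forall>j\<in>{..<k}. i \<noteq> j \<longrightarrow> (F i - R) \<inter> (F j - R) = {}"
      using disj unfolding disjoint_family_on_def by blast
  qed (use finF in auto)
  finally have "k * (c - 1) + (\<Sum>i<k. card V - c) \<le>
      (\<Sum>i<k. card (F i - R)) + (\<Sum>i<k. card (F i \<inter> R))"
    using outside inside by simp
  also have "\<dots> = (\<Sum>i<k. card (F i - R) + card (F i \<inter> R))" by (simp add: sum.distrib)
  also have "\<dots> = (\<Sum>i<k. card (F i))"
  proof (rule sum.cong)
    show "card (F i - R) + card (F i \<inter> R) = card (F i)" if "i \<in> {..<k}" for i
      using card_Int_Diff[OF finF, of i R] that by simp
  qed simp
  finally have total_ge: "k * (c - 1) + k * (card V - c) \<le> (\<Sum>i<k. card (F i))" by simp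
  have "c \<le> card V" unfolding c_def components_def using card_image_le[OF finV] .
  then have "(c - 1) + (card V - c) = card V - 1" using pos[of R] unfolding c_def by simp
  then have total: "k * (card V - 1) \<le> (\<Sum>i<k. card (F i))"
    using total_ge by (simp flip: distrib_left)
  have le: "card (F i) \<le> card V - 1" if "i < k" for i
    using count[OF that order_refl] pos[of "F i"] by simp
  have size: "card (F i) = card V - 1" if i: "i < k" for i
  proof (rule ccontr)
    assume "card (F i) \<noteq> card V - 1"
    then have "card (F i) < card V - 1" using le[OF i] by simp
    then have "(\<Sum>i<k. card (F i)) < (\<Sum>i<k. card V - 1)"
      using i le by (intro sum_strict_mono_ex1) (simp_all, blast)
    then show False using total by simp
  qed
  have connected: "conn (F i) x y" if i: "i < k" and "x \<in> V" "y \<in> V" for i x y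
  proof -
    have "card V \<ge> 1" using finV \<open>V \<noteq> {}\<close> by (simp add: Suc_le_eq card_gt_0_iff)
    then have "card (components V (F i)) = 1"
      using count[OF i order_refl] size[OF i] by simp
    then obtain X where "components V (F i) = {X}" by (rule card_1_singletonE)
    then have "component V (F i) x = component V (F i) y"
      using that unfolding components_def by blast
    then show ?thesis using component_eq_iff[OF \<open>y \<in> V\<close>] by simp
  qed
  show thesis by (rule that[OF FE disj size connected])
qed

section \<open>Coloring by spanning trees\<close>

lemma path_edges_Cons:
  assumes "p \<noteq> []"
  shows "path_edges (x # p) = insert {x, hd p} (path_edges p)"
proof (intro subset_antisym subsetI)
  fix e assume "e \<in> path_edges (x # p)"
  then obtain i where i: "e = {(x # p) ! i, (x # p) ! Suc i}" "Suc i < length (x # p)"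
    unfolding path_edges_def by blast
  show "e \<in> insert {x, hd p} (path_edges p)"
  proof (cases i)
    case 0
    then show ?thesis using i(1) assms by (simp add: hd_conv_nth)
  next
    case (Suc j)
    then have "e = {p ! j, p ! Suc j}" "Suc j < length p" using i by simp_all
    then show ?thesis unfolding path_edges_def by blast
  qed
next
  fix e assume "e \<in> insert {x, hd p} (path_edges p)"
  then consider "e = {x, hd p}" | i where "e = {p ! i, p ! Suc i}" "Suc i < length p"
    unfolding path_edges_def by blast
  then show "e \<in> path_edges (x # p)"
  proof cases
    case 1
    then show ?thesis unfolding path_edges_def using assms
      by (intro CollectI exI[of _ 0]) (simp add: hd_conv_nth)
  next
    case 2
    then show ?thesis unfolding path_edges_def by (intro CollectI exI[of _ "Suc i"]) simp
  qed
qed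

lemma path_edges_append: "path_edges q \<subseteq> path_edges (p @ q)"
proof (induction p)
  case (Cons x p)
  show ?case
  proof (cases "p @ q = []")
    case True
    then show ?thesis by (simp add: path_edges_def)
  next
    case False
    then show ?thesis using Cons path_edges_Cons[of "p @ q" x] by auto
  qed
qed simp

lemma conn_imp_path:
  assumes "conn A u v" "\<Union>A \<subseteq> V" "u \<in> V"
  shows "\<exists>p. is_uv_path V A u v p"
proof -
  have "(\<lambda>x y. {x, y} \<in> A)\<^sup>*\<^sup>* u v" using assms(1) unfolding conn_def .
  then show ?thesis using assms(3)
  proof (induction rule: converse_rtranclp_induct)
    case base
    then have "is_uv_path V A v v [v]" unfolding is_uv_path_def path_edges_def by simp
    then show ?case by blast
  next
    case (step u w)
    have "w \<in> V" using step.hyps(1) assms(2) by blast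
    then obtain p where p: "is_uv_path V A w v p" using step.IH by blast
    show ?case
    proof (cases "u \<in> set p")
      case False
      then have "is_uv_path V A u v (u # p)"
        using p step.hyps(1) step.prems path_edges_Cons[of p u] unfolding is_uv_path_def by auto
      then show ?thesis by blast
    next
      case True
      then obtain xs ys where "p = xs @ u # ys" using split_list by metis
      then have "is_uv_path V A u v (u # ys)"
        using p path_edges_append[of "u # ys" xs] unfolding is_uv_path_def by auto
      then show ?thesis by blast
    qed
  qed
qed

lemma path_edges_nonempty:
  assumes "is_uv_path V E u v p" "u \<noteq> v"
  shows "path_edges p \<noteq> {}"
proof -
  obtain x q where p: "p = x # q" using assms(1) unfolding is_uv_path_def by (cases p) auto
  then have "q \<noteq> []" using assms unfolding is_uv_path_def by auto
  then show ?thesis using path_edges_Cons[of q x] p by simp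
qed

lemma RMC_coloring_by_connected_subgraphs:
  assumes G: "finite_simple_graph V E"
    and FE: "\<And>i. i < k \<Longrightarrow> F i \<subseteq> E" and disj: "disjoint_family_on F {..<k}"
    and connected: "\<And>i x y. \<lbrakk>i < k; x \<in> V; y \<in> V\<rbrakk> \<Longrightarrow> conn (F i) x y"
    and col: "\<And>i e. \<lbrakk>i < k; e \<in> F i\<rbrakk> \<Longrightarrow> c e = i"
  shows "RMC_coloring k V E c"
  unfolding RMC_coloring_def
proof (intro ballI impI)
  fix u v assume uv: "u \<in> V" "v \<in> V" "u \<noteq> v"
  have "\<exists>p. is_uv_path V (F i) u v p" if "i < k" for i
  proof (rule conn_imp_path[OF connected[OF that uv(1,2)] _ uv(1)])
    show "\<Union>(F i) \<subseteq> V" using FE[OF that] G unfolding finite_simple_graph_def by blast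
  qed
  then obtain p where p: "\<And>i. i < k \<Longrightarrow> is_uv_path V (F i) u v (p i)" by metis
  have sub: "path_edges (p i) \<subseteq> F i" if "i < k" for i
    using p[OF that] unfolding is_uv_path_def by blast
  have colors: "path_colors c (p i) = {i}" if "i < k" for i
    using path_edges_nonempty[OF p[OF that] uv(3)] sub[OF that] col[OF that]
    unfolding path_colors_def by blast
  let ?Q = "p ` {..<k}"
  have "inj_on p {..<k}" by (rule inj_onI) (metis colors lessThan_iff singleton_inject)
  then have "card ?Q = k" by (simp add: card_image)
  moreover have "rainbow_monochromatic_paths V E c u v ?Q"
    unfolding rainbow_monochromatic_paths_def
  proof (intro conjI ballI)
    fix q assume "q \<in> ?Q"
    then obtain i where i: "i < k" "q = p i" by blast
    show "is_uv_path V E u v q"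
      using p[OF i(1)] FE[OF i(1)] unfolding i(2) is_uv_path_def by blast
    show "monochromatic c q" using colors[OF i(1)] unfolding i(2) monochromatic_def by blast
  next
    show "disjoint_family_on path_edges ?Q"
      unfolding disjoint_family_on_def
    proof (intro ballI impI)
      fix q r assume "q \<in> ?Q" "r \<in> ?Q" "q \<noteq> r"
      then obtain i j where ij: "q = p i" "r = p j" "i < k" "j < k" "i \<noteq> j" by blast
      then have "F i \<inter> F j = {}" using disj unfolding disjoint_family_on_def by blast
      then show "path_edges q \<inter> path_edges r = {}" using sub ij by blast
    qed
    show "inj_on (path_colors c) ?Q" by (rule inj_onI) (auto simp: colors)
  qed
  ultimately show "\<exists>Q. finite Q \<and> card Q \<ge> k \<and> rainbow_monochromatic_paths V E c u v Q"
    by (intro exI[of _ ?Q]) simp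
qed

lemma rmc_ge:
  assumes "finite E" "RMC_coloring k V E c"
  shows "card (c ` E) \<le> rmc k V E"
proof -
  have "{card (c ` E) | c. RMC_coloring k V E c} \<subseteq> {..card E}"
    using card_image_le[OF assms(1)] by blast
  then have "finite {card (c ` E) | c. RMC_coloring k V E c}"
    by (rule finite_subset) simp
  then show ?thesis unfolding rmc_def using assms(2) by (intro Max_ge) auto
qed

theorem corollary3p4:
  fixes V :: "'a set" and E :: "'a set set" and k n m :: nat
  assumes "k \<ge> 1"
    and "finite_simple_graph V E"
    and "n = card V" and "n \<ge> 2"
    and "m = card E"
    and "tau V E \<ge> real k"
  shows "int (rmc k V E) \<ge> int m - int k * (int n - 2)"
proof -
  have finE: "finite E"
    using assms(2) unfolding finite_simple_graph_def by (intro finite_subset[of E "Pow V"]) auto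
  have "V \<noteq> {}" using assms(3,4) by auto
  then obtain F where FE: "\<And>i. i < k \<Longrightarrow> F i \<subseteq> E" and disj: "disjoint_family_on F {..<k}"
    and size: "\<And>i. i < k \<Longrightarrow> card (F i) = n - 1"
    and connected: "\<And>i x y. \<lbrakk>i < k; x \<in> V; y \<in> V\<rbrakk> \<Longrightarrow> conn (F i) x y"
    using tree_packing[OF assms(2) _ assms(6)] unfolding assms(3) by metis
  let ?T = "\<Union>i<k. F i"
  have TE: "?T \<subseteq> E" using FE by blast
  have finF: "finite (F i)" if "i < k" for i using FE[OF that] finE finite_subset by blast
  have cT: "card ?T = k * (n - 1)"
    using disj finF size by (subst card_UN_disjoint) (auto simp: disjoint_family_on_def)
  obtain g :: "'a set \<Rightarrow> nat" where g: "inj_on g E"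
    using finite_imp_inj_to_nat_seg[OF finE] by blast
  define c where "c e = (if e \<in> ?T then THE i. i < k \<and> e \<in> F i else k + g e)" for e
  have col: "c e = i" if "i < k" "e \<in> F i" for i e
  proof -
    have "j = i" if "j < k" "e \<in> F j" for j
      using disj that \<open>i < k\<close> \<open>e \<in> F i\<close> unfolding disjoint_family_on_def by blast
    then have "(THE j. j < k \<and> e \<in> F j) = i" using that by blast
    then show ?thesis using that unfolding c_def by auto
  qed
  have "RMC_coloring k V E c"
    using RMC_coloring_by_connected_subgraphs[OF assms(2) FE disj connected col] .
  then have ge: "card (c ` E) \<le> rmc k V E" by (rule rmc_ge[OF finE])
  have "{..<k} \<subseteq> c ` ?T"
  proof
    fix i assume "i \<in> {..<k}"
    then have i: "i < k" by simp
    then have "F i \<noteq> {}" using size[OF i] assms(4) by auto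
    then show "i \<in> c ` ?T" using col[OF i] i by blast
  qed
  then have "{..<k} \<union> c ` (E - ?T) \<subseteq> c ` E" using TE by blast
  then have "card ({..<k} \<union> c ` (E - ?T)) \<le> card (c ` E)" using finE by (intro card_mono) auto
  moreover have "card ({..<k} \<union> c ` (E - ?T)) = k + card (c ` (E - ?T))"
    using finE by (subst card_Un_disjoint) (auto simp: c_def)
  moreover have "card (c ` (E - ?T)) = m - k * (n - 1)"
  proof -
    have "inj_on c (E - ?T)" using g unfolding inj_on_def c_def by auto
    then have "card (c ` (E - ?T)) = card (E - ?T)" by (rule card_image)
    also have "\<dots> = card E - card ?T" using TE finE by (meson card_Diff_subset finite_subset)
    finally show ?thesis using cT assms(5) by simp
  qed
  ultimately have "k + (m - k * (n - 1)) \<le> rmc k V E" using ge by simp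
  then have "int k + (int m - int (k * (n - 1))) \<le> int (rmc k V E)" by linarith
  moreover have "int (k * (n - 1)) = int k * (int n - 2) + int k"
    using assms(4) by (simp add: of_nat_diff algebra_simps)
  ultimately show ?thesis by linarith
qed

end
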